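(* Let $X$ be a real normed space and let $f:X\to\mathbb{R}$ be a real-valued function. If $f$ is Lipschitz bounded from above on $X$, then the upper semicontinuous closure $(\mathrm{cl} f)^{\uparrow}$ of $f$ admits the representation $$(\mathrm{cl} f)^{\uparrow}(x)=\inf_{g\in\Sigma^+_{Lip}(f)} g(x)\quad\text{for all } x\in X.$$
   Context: $\overline{\mathbb{R}}=\mathbb{R}\cup\{\pm\infty\}$. The upper semicontinuous closure of $f$ is its smallest upper semicontinuous majorant, $(\mathrm{cl} f)^{\uparrow}(x)=\limsup_{y\to x} f(y)$ (where $y=x$ is allowed). A function $g:X\to\overline{\mathbb{R}}$ is convex if $g(x)>-\infty$ for all $x\in X$ and its epigraph $\{(x,\alpha)\in X\times\mathbb{R}: g(x)\le\alpha\}$ is a nonempty convex set. A convex majorant of $f$ is a convex function $g:X\to\overline{\mathbb{R}}$ with $f\le g$ pointwise on $X$; a minimal convex majorant of $f$ is a convex majorant that is minimal, for the pointwise ordering, among all convex majorants of $f$. $\Sigma^+_{Lip}(f)$ is the set of all minimal convex majorants of $f$ that are (real-valued and) Lipschitz continuous on the whole of $X$. $f$ is Lipschitz bounded from above on $X$ if there is a function $\psi:X\to\mathbb{R}$, Lipschitz continuous on $X$, with $f(x)\le\psi(x)$ for all $x\in X$. *)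

theory Defs
  imports "HOL-Analysis.Analysis"
begin

definition usc :: "('a::topological_space \<Rightarrow> ereal) \<Rightarrow> bool" where
  "usc g \<longleftrightarrow> (\<forall>c. open {x. g x < c})"

text \<open>The filter \<^term>\<open>nhds x\<close>, unlike \<^term>\<open>at x\<close>, does not exclude the point \<open>x\<close> itself.\<close>

definition usc_closure :: "('a::topological_space \<Rightarrow> ereal) \<Rightarrow> 'a \<Rightarrow> ereal" where
  "usc_closure f x = Limsup (nhds x) f"

lemma usc_closure_least_usc_majorant:
  fixes f :: "'a::topological_space \<Rightarrow> ereal"
  shows "usc (usc_closure f)" "f \<le> usc_closure f"
    and "\<And>g. usc g \<Longrightarrow> f \<le> g \<Longrightarrow> usc_closure f \<le> g"
proof -
  have less_iff: "usc_closure f x < c \<longleftrightarrow> (\<exists>d<c. \<exists>S. open S \<and> x \<in> S \<and> (\<forall>y\<in>S. f y < d))" for x c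
  proof
    assume "usc_closure f x < c"
    from dense[OF this] obtain d where d: "Limsup (nhds x) f < d" "d < c"
      unfolding usc_closure_def by (elim exE conjE)
    from Limsup_lessD[OF d(1)] have "\<exists>S. open S \<and> x \<in> S \<and> (\<forall>y\<in>S. f y < d)"
      unfolding eventually_nhds .
    with d(2) show "\<exists>d<c. \<exists>S. open S \<and> x \<in> S \<and> (\<forall>y\<in>S. f y < d)"
      by (intro exI[of _ d] conjI)
  next
    assume "\<exists>d<c. \<exists>S. open S \<and> x \<in> S \<and> (\<forall>y\<in>S. f y < d)"
    then have "\<exists>d<c. eventually (\<lambda>y. f y < d) (nhds x)"
      unfolding eventually_nhds .
    then obtain d where d: "d < c" and S: "eventually (\<lambda>y. f y < d) (nhds x)"
      by (elim exE conjE)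
    from S have "eventually (\<lambda>y. f y \<le> d) (nhds x)"
      by (rule eventually_mono) (rule less_imp_le)
    from Limsup_bounded[OF this] d show "usc_closure f x < c"
      unfolding usc_closure_def by (rule le_less_trans)
  qed
  show "usc (usc_closure f)"
    unfolding usc_def
  proof (rule allI, subst open_subopen, rule ballI)
    fix c x assume "x \<in> {x. usc_closure f x < c}"
    then have "usc_closure f x < c" by simp
    then obtain d S where dS: "d < c" "open S" "x \<in> S" "\<forall>y\<in>S. f y < d"
      unfolding less_iff by (elim exE conjE)
    have "usc_closure f z < c" if "z \<in> S" for z
      unfolding less_iff using dS that by (intro exI[of _ d] exI[of _ S] conjI)
    then have "S \<subseteq> {x. usc_closure f x < c}" by (intro subsetI CollectI)
    with dS show "\<exists>T. open T \<and> x \<in> T \<and> T \<subseteq> {x. usc_closure f x < c}"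
      by (intro exI[of _ S] conjI)
  qed
  show "f \<le> usc_closure f"
  proof (rule le_funI, rule ccontr)
    fix x assume "\<not> f x \<le> usc_closure f x"
    then have "usc_closure f x < f x" by simp
    then obtain d S where dS: "d < f x" "x \<in> S" "\<forall>y\<in>S. f y < d"
      unfolding less_iff by (elim exE conjE)
    from dS(3,2) have "f x < d" by (rule bspec)
    with dS(1) show False by simp
  qed
  fix g assume g: "usc g" "f \<le> g"
  show "usc_closure f \<le> g"
  proof (rule le_funI, rule dense_ge)
    fix x d assume d: "g x < d"
    have "open {y. g y < d}" using g(1) unfolding usc_def by (rule spec)
    moreover have "f y \<le> d" if "g y < d" for y
      using le_funD[OF g(2), of y] that by (meson le_less_trans less_imp_le)
    ultimately have "eventually (\<lambda>y. f y \<le> d) (nhds x)"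
      unfolding eventually_nhds using d by (intro exI[of _ "{y. g y < d}"]) simp
    then show "usc_closure f x \<le> d"
      unfolding usc_closure_def by (rule Limsup_bounded)
  qed
qed

text \<open>The library's \<^const>\<open>epigraph\<close> and \<^const>\<open>convex_on\<close> only cover real-valued functions.\<close>

definition ereal_epigraph :: "('a \<Rightarrow> ereal) \<Rightarrow> ('a \<times> real) set" where
  "ereal_epigraph g = {(x, \<alpha>). g x \<le> ereal \<alpha>}"

definition ereal_convex :: "('a::real_vector \<Rightarrow> ereal) \<Rightarrow> bool" where
  "ereal_convex g \<longleftrightarrow>
     (\<forall>x. g x > -\<infinity>) \<and> ereal_epigraph g \<noteq> {} \<and> convex (ereal_epigraph g)"

definition convex_majorant :: "('a::real_vector \<Rightarrow> ereal) \<Rightarrow> ('a \<Rightarrow> ereal) \<Rightarrow> bool" where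
  "convex_majorant f g \<longleftrightarrow> ereal_convex g \<and> (\<forall>x. f x \<le> g x)"

definition minimal_convex_majorant :: "('a::real_vector \<Rightarrow> ereal) \<Rightarrow> ('a \<Rightarrow> ereal) \<Rightarrow> bool" where
  "minimal_convex_majorant f g \<longleftrightarrow>
     convex_majorant f g \<and> (\<forall>h. convex_majorant f h \<and> (\<forall>x. h x \<le> g x) \<longrightarrow> h = g)"

definition lipschitz_continuous :: "('a::metric_space \<Rightarrow> real) \<Rightarrow> bool" where
  "lipschitz_continuous h \<longleftrightarrow> (\<exists>L. L-lipschitz_on UNIV h)"

definition Sigma_Lip_plus :: "('a::real_normed_vector \<Rightarrow> ereal) \<Rightarrow> ('a \<Rightarrow> ereal) set" where
  "Sigma_Lip_plus f =
     {g. minimal_convex_majorant f g \<and>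
         (\<exists>h. lipschitz_continuous h \<and> (\<forall>x. g x = ereal (h x)))}"

definition lipschitz_bounded_above :: "('a::metric_space \<Rightarrow> ereal) \<Rightarrow> bool" where
  "lipschitz_bounded_above f \<longleftrightarrow>
     (\<exists>\<psi>. lipschitz_continuous \<psi> \<and> (\<forall>x. f x \<le> ereal (\<psi> x)))"

end

theory Submission
  imports Defs
begin

text \<open>
  If \<open>d > usc_closure f x\<^sub>0\<close>, then \<open>f < d\<close> near \<open>x\<^sub>0\<close>, so the Lipschitz upper bound
  makes the cone \<open>d + M * norm (y - x\<^sub>0)\<close> a convex majorant of \<open>f\<close> once \<open>M\<close> is large.
  Zorn's lemma yields a minimal convex majorant below this cone, and a finite convex function that
  grows at most linearly with slope \<open>M\<close> is automatically \<open>M\<close>-Lipschitz on the whole space.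
\<close>

text \<open>Infima do not preserve convexity in general. In a chain, of two members that nearly
  attain the infimum at \<open>x\<close> and at \<open>y\<close>, the smaller one does so at both
  points, and its convexity inequality passes to the limit.\<close>

lemma convex_on_cINF_chain:
  fixes C :: "('a::real_vector \<Rightarrow> real) set"
  assumes C: "C \<noteq> {}" "\<And>g. g \<in> C \<Longrightarrow> convex_on UNIV g"
    and bdd: "\<And>x. bdd_below ((\<lambda>g. g x) ` C)"
    and chain: "\<And>g h. g \<in> C \<Longrightarrow> h \<in> C \<Longrightarrow> g \<le> h \<or> h \<le> g"
  shows "convex_on UNIV (\<lambda>x. INF g\<in>C. g x)"
proof
  fix t :: real and x y :: 'a
  assume t: "0 < t" "t < 1"
  let ?I = "\<lambda>x. INF g\<in>C. g x"
  let ?z = "(1 - t) *\<^sub>R x + t *\<^sub>R y"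
  show "?I ?z \<le> (1 - t) * ?I x + t * ?I y"
  proof (rule field_le_epsilon)
    fix e :: real
    assume "e > 0"
    then obtain g h where g: "g \<in> C" "g x < ?I x + e" and h: "h \<in> C" "h y < ?I y + e"
      using cINF_less_iff[OF C(1) bdd, of x "?I x + e"] cINF_less_iff[OF C(1) bdd, of y "?I y + e"]
      by auto
    obtain m where m: "m \<in> C" "m x \<le> g x" "m y \<le> h y"
      using chain[OF g(1) h(1)] g(1) h(1) by (auto simp: le_fun_def)
    have "?I ?z \<le> m ?z"
      by (rule cINF_lower[OF bdd m(1)])
    also have "\<dots> \<le> (1 - t) * m x + t * m y"
      using convex_onD[OF C(2)[OF m(1)]] t by simp
    also have "\<dots> \<le> (1 - t) * (?I x + e) + t * (?I y + e)"
      using m g h t by (intro add_mono mult_left_mono) auto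
    finally show "?I ?z \<le> (1 - t) * ?I x + t * ?I y + e"
      by (simp add: algebra_simps)
  qed
qed simp

text \<open>Zorn's lemma for the convex functions between \<open>f\<close> and \<open>h\<close>:
  since \<open>f\<close> bounds every nonempty chain from below, its pointwise infimum is finite and
  again lies between them.\<close>

lemma ex_minimal_convex_on_between:
  fixes f h :: "'a::real_vector \<Rightarrow> real"
  assumes "convex_on UNIV h" "f \<le> h"
  shows "\<exists>g. convex_on UNIV g \<and> f \<le> g \<and> g \<le> h \<and>
    (\<forall>k. convex_on UNIV k \<and> f \<le> k \<and> k \<le> g \<longrightarrow> k = g)"
proof -
  define A where "A = {g. convex_on UNIV g \<and> f \<le> g \<and> g \<le> h}"
  \<comment> \<open>The order is reversed because \<open>predicate_Zorn\<close> yields a maximal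
    element.\<close>
  let ?P = "\<lambda>g k :: 'a \<Rightarrow> real. k \<le> g"
  have "\<exists>m\<in>A. \<forall>a\<in>A. ?P m a \<longrightarrow> a = m"
  proof (rule predicate_Zorn)
    show "partial_order_on A (relation_of ?P A)"
      by (rule partial_order_on_relation_ofI) auto
    fix C
    assume "C \<in> Chains (relation_of ?P A)"
    then have CA: "C \<subseteq> A" and chain: "\<And>g k. g \<in> C \<Longrightarrow> k \<in> C \<Longrightarrow> g \<le> k \<or> k \<le> g"
      by (auto simp: Chains_def relation_of_def)
    show "\<exists>u\<in>A. \<forall>a\<in>C. ?P a u"
    proof (cases "C = {}")
      case True
      \<comment> \<open>The empty chain also needs a bound in \<open>A\<close>; \<open>h\<close>
        itself serves.\<close>
      then show ?thesis using assms by (auto simp: A_def)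
    next
      case False
      have bdd: "bdd_below ((\<lambda>g. g x) ` C)" for x
        using CA by (intro bdd_belowI[of _ "f x"]) (auto simp: A_def le_fun_def)
      let ?I = "\<lambda>x. INF g\<in>C. g x"
      have lower: "?I \<le> g" if "g \<in> C" for g
        using cINF_lower[OF bdd that] by (simp add: le_fun_def)
      have "convex_on UNIV ?I"
        using CA chain bdd False by (intro convex_on_cINF_chain) (auto simp: A_def)
      moreover have "f \<le> ?I"
        using CA False by (auto simp: A_def le_fun_def intro!: cINF_greatest)
      moreover obtain g where "g \<in> C" using False by auto
      then have "?I \<le> h"
        using lower[of g] CA by (auto simp: A_def)
      ultimately show ?thesis
        using lower by (intro bexI[of _ ?I]) (auto simp: A_def)
    qed
  qed
  then obtain m where m: "m \<in> A" "\<And>a. a \<in> A \<Longrightarrow> a \<le> m \<Longrightarrow> a = m" by blast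
  \<comment> \<open>Whatever lies below \<open>m\<close> lies below \<open>h\<close>, so minimality
    within \<open>A\<close> is minimality among all convex majorants.\<close>
  have "k \<in> A" if "convex_on UNIV k" "f \<le> k" "k \<le> m" for k
    using m(1) that by (auto simp: A_def)
  with m show ?thesis by (intro exI[of _ m]) (auto simp: A_def)
qed

text \<open>If the slope from \<open>x\<close> to \<open>y\<close> exceeded \<open>M\<close>,
  convexity would keep it at least as large along the rest of the ray, and \<open>g\<close> would
  outgrow the cone. Moving the apex from \<open>x\<^sub>0\<close> to \<open>x\<close> costs only a
  constant.\<close>

lemma convex_on_linear_growth_imp_lipschitz:
  fixes g :: "'a::real_normed_vector \<Rightarrow> real"
  assumes g: "convex_on UNIV g" and bound: "\<And>y. g y \<le> a + M * norm (y - x\<^sub>0)" and M: "0 \<le> M"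
  shows "M-lipschitz_on UNIV g"
proof -
  have le: "g y - g x \<le> M * norm (y - x)" for x y
  proof (rule ccontr)
    \<comment> \<open>\<open>s\<close> is the excess of the increment over slope \<open>M\<close>;
      \<open>K\<close> is what the growth bound leaves for such an excess, uniformly along the
      ray.\<close>
    define s where "s = g y - g x - M * norm (y - x)"
    define K where "K = a + M * norm (x - x\<^sub>0) - g x"
    assume "\<not> g y - g x \<le> M * norm (y - x)"
    then have s: "s > 0" by (simp add: s_def)
    \<comment> \<open>As \<open>y\<close> has weight \<open>1/t\<close> on the segment from
      \<open>x\<close> to \<open>?w\<close>, convexity multiplies the excess at \<open>?w\<close> at
      least by \<open>t\<close>.\<close>
    have scaled: "t * s \<le> K" if t: "t \<ge> 1" for t
    proof -
      let ?w = "x + t *\<^sub>R (y - x)"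
      have y: "y = (1 - 1/t) *\<^sub>R x + (1/t) *\<^sub>R ?w"
        using t by (simp add: algebra_simps)
      have "g y \<le> (1 - 1/t) * g x + (1/t) * g ?w"
        using convex_onD[OF g, of "1/t" x ?w] t by (subst y) simp
      then have "t * g y \<le> t * ((1 - 1/t) * g x + (1/t) * g ?w)"
        using t by (intro mult_left_mono) auto
      also have "\<dots> = (t - 1) * g x + g ?w"
        using t by (simp add: field_simps)
      also have "g ?w \<le> a + M * norm (?w - x\<^sub>0)" by (rule bound)
      also have "norm (?w - x\<^sub>0) \<le> norm (x - x\<^sub>0) + t * norm (y - x)"
        using norm_triangle_ineq[of "x - x\<^sub>0" "t *\<^sub>R (y - x)"] t by (simp add: diff_add_eq)
      finally have "t * g y \<le> (t - 1) * g x + (a + M * (norm (x - x\<^sub>0) + t * norm (y - x)))"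
        using M by (simp add: mult_left_mono)
      then show ?thesis by (simp add: s_def K_def algebra_simps)
    qed
    \<comment> \<open>Beyond \<open>K / s\<close> the scaled excess passes \<open>K\<close>; the
      maximum with 1 keeps \<open>y\<close> between \<open>x\<close> and \<open>?w\<close>.\<close>
    define t where "t = max 1 (K / s + 1)"
    have "K < (K / s + 1) * s" using s by (simp add: field_simps)
    also have "\<dots> \<le> t * s" using s by (intro mult_right_mono) (auto simp: t_def)
    finally show False using scaled[of t] by (simp add: t_def)
  qed
  show ?thesis
  proof (rule lipschitz_onI[OF _ M])
    fix x y
    show "dist (g x) (g y) \<le> M * dist x y"
      using le[of x y] le[of y x] by (simp add: dist_real_def dist_norm norm_minus_commute)
  qed
qed

text \<open>Finite values make properness automatic, so only convexity of the epigraph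
  remains.\<close>

lemma ereal_convex_iff_convex_on:
  "ereal_convex (\<lambda>x. ereal (g x)) \<longleftrightarrow> convex_on UNIV g"
proof -
  have "ereal_epigraph (\<lambda>x. ereal (g x)) = epigraph UNIV g"
    by (auto simp: ereal_epigraph_def epigraph_def)
  moreover have "(0, g 0) \<in> epigraph UNIV g" by (simp add: mem_epigraph)
  ultimately show ?thesis by (auto simp: ereal_convex_def convex_epigraph)
qed

text \<open>An extended-real competitor below \<open>g\<close> is squeezed between the finite
  functions \<open>f\<close> and \<open>g\<close>, hence is itself real-valued. Minimality can
  therefore be tested on real functions alone.\<close>

lemma minimal_convex_majorant_ereal_iff:
  fixes f g :: "'a::real_vector \<Rightarrow> real"
  shows "minimal_convex_majorant (\<lambda>x. ereal (f x)) (\<lambda>x. ereal (g x)) \<longleftrightarrow>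
    convex_on UNIV g \<and> f \<le> g \<and> (\<forall>k. convex_on UNIV k \<and> f \<le> k \<and> k \<le> g \<longrightarrow> k = g)"
    (is "?L \<longleftrightarrow> ?R")
proof
  assume L: ?L
  have "k = g" if "convex_on UNIV k" "f \<le> k" "k \<le> g" for k
  proof -
    have "(\<lambda>x. ereal (k x)) = (\<lambda>x. ereal (g x))"
      using L that by (auto simp: minimal_convex_majorant_def convex_majorant_def
          ereal_convex_iff_convex_on le_fun_def)
    then show ?thesis by (auto simp: fun_eq_iff)
  qed
  with L show ?R
    by (auto simp: minimal_convex_majorant_def convex_majorant_def ereal_convex_iff_convex_on le_fun_def)
next
  assume R: ?R
  have "h = (\<lambda>x. ereal (g x))"
    if h: "ereal_convex h" "\<And>x. ereal (f x) \<le> h x" "\<And>x. h x \<le> ereal (g x)" for h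
  proof -
    define k where "k = (\<lambda>x. real_of_ereal (h x))"
    have hk: "h x = ereal (k x)" for x
      using h(2,3)[of x] by (cases "h x") (auto simp: k_def)
    then have "h = (\<lambda>x. ereal (k x))" by auto
    moreover have "k = g"
      using R h calculation by (auto simp: ereal_convex_iff_convex_on le_fun_def)
    ultimately show ?thesis by simp
  qed
  with R show ?L
    by (auto simp: minimal_convex_majorant_def convex_majorant_def ereal_convex_iff_convex_on le_fun_def)
qed

lemma convex_on_cone:
  fixes x\<^sub>0 :: "'a::real_normed_vector"
  assumes "0 \<le> M"
  shows "convex_on UNIV (\<lambda>y. a + M * norm (y - x\<^sub>0))"
proof -
  have "convex_on UNIV (\<lambda>y. dist x\<^sub>0 y)" by (rule convex_on_dist) simp
  then show ?thesis
    using assms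
    by (intro convex_on_add convex_on_cmul) (auto simp: convex_on_const dist_norm norm_minus_commute)
qed

lemma lipschitz_bounded_below_cone:
  fixes f :: "'a::real_normed_vector \<Rightarrow> real"
  assumes "lipschitz_bounded_above (\<lambda>x. ereal (f x))"
    and "usc_closure (\<lambda>x. ereal (f x)) x\<^sub>0 < ereal d"
  obtains M where "0 \<le> M" "\<And>y. f y \<le> d + M * norm (y - x\<^sub>0)"
proof -
  obtain \<psi> L where L: "L-lipschitz_on UNIV \<psi>" and \<psi>: "\<And>x. f x \<le> \<psi> x"
    using assms(1) by (auto simp: lipschitz_bounded_above_def lipschitz_continuous_def)
  have "eventually (\<lambda>y. f y < d) (nhds x\<^sub>0)"
    using Limsup_lessD[OF assms(2)[unfolded usc_closure_def]] by simp
  then obtain \<delta> where \<delta>: "\<delta> > 0" "\<And>y. dist y x\<^sub>0 < \<delta> \<Longrightarrow> f y < d"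
    by (auto simp: eventually_nhds_metric)
  \<comment> \<open>The term \<open>L\<close> pays for the growth of \<open>\<psi>\<close>. The
    quotient pays for the gap between \<open>\<psi> x\<^sub>0\<close> and \<open>d\<close>, which
    must be covered only at distance at least \<open>\<delta>\<close>, since \<open>f\<close> stays
    below \<open>d\<close> nearer to \<open>x\<^sub>0\<close>.\<close>
  define M where "M = L + \<bar>\<psi> x\<^sub>0 - d\<bar> / \<delta>"
  have "L \<ge> 0" using L by (rule lipschitz_on_nonneg)
  then have M: "0 \<le> M" using \<delta> by (simp add: M_def)
  have "f y \<le> d + M * norm (y - x\<^sub>0)" for y
  proof (cases "dist y x\<^sub>0 < \<delta>")
    case True
    then have "f y < d" by (rule \<delta>(2))
    moreover have "0 \<le> M * norm (y - x\<^sub>0)" using M by simp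
    ultimately show ?thesis by linarith
  next
    case False
    have "\<bar>\<psi> x\<^sub>0 - d\<bar> = \<bar>\<psi> x\<^sub>0 - d\<bar> / \<delta> * \<delta>" using \<delta> by simp
    also have "\<dots> \<le> \<bar>\<psi> x\<^sub>0 - d\<bar> / \<delta> * dist y x\<^sub>0"
      using False \<delta>(1) by (intro mult_left_mono) auto
    finally have "\<psi> x\<^sub>0 - d \<le> \<bar>\<psi> x\<^sub>0 - d\<bar> / \<delta> * dist y x\<^sub>0" by linarith
    moreover have "\<psi> y - \<psi> x\<^sub>0 \<le> L * dist y x\<^sub>0"
      using lipschitz_onD[OF L, of y x\<^sub>0] by (simp add: dist_real_def)
    ultimately show ?thesis
      using \<psi>[of y] by (simp add: M_def dist_norm distrib_right)
  qed
  with M show thesis by (rule that)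
qed

text \<open>Continuous functions are upper semicontinuous, and the closure is the least upper
  semicontinuous majorant.\<close>

lemma usc_closure_le_continuous:
  assumes "continuous_on UNIV h" "\<And>x. f x \<le> ereal (h x)"
  shows "usc_closure f x \<le> ereal (h x)"
proof -
  have "continuous_on UNIV (\<lambda>x. ereal (h x))"
    using assms(1) by (rule continuous_on_ereal)
  then have "usc (\<lambda>x. ereal (h x))"
    unfolding usc_def by (intro allI open_Collect_less) auto
  then show ?thesis
    using usc_closure_least_usc_majorant(3)[of "\<lambda>x. ereal (h x)" f] assms(2)
    by (simp add: le_fun_def)
qed

theorem theorem4p7:
  fixes f :: "'a::real_normed_vector \<Rightarrow> real"
  assumes "lipschitz_bounded_above (\<lambda>x. ereal (f x))"
  shows "\<forall>x. usc_closure (\<lambda>x. ereal (f x)) x = (INF g\<in>Sigma_Lip_plus (\<lambda>x. ereal (f x)). g x)"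
proof (intro allI antisym)
  fix x\<^sub>0
  show "usc_closure (\<lambda>x. ereal (f x)) x\<^sub>0 \<le> (INF g\<in>Sigma_Lip_plus (\<lambda>x. ereal (f x)). g x\<^sub>0)"
  proof (rule INF_greatest)
    fix g
    assume "g \<in> Sigma_Lip_plus (\<lambda>x. ereal (f x))"
    then obtain h L where h: "L-lipschitz_on UNIV h" "\<And>x. g x = ereal (h x)"
      and fg: "\<And>x. ereal (f x) \<le> g x"
      by (auto simp: Sigma_Lip_plus_def lipschitz_continuous_def minimal_convex_majorant_def
          convex_majorant_def)
    show "usc_closure (\<lambda>x. ereal (f x)) x\<^sub>0 \<le> g x\<^sub>0"
      using usc_closure_le_continuous[OF lipschitz_on_continuous_on[OF h(1)] fg[unfolded h(2)]]
      by (simp add: h(2))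
  qed
  show "(INF g\<in>Sigma_Lip_plus (\<lambda>x. ereal (f x)). g x\<^sub>0) \<le> usc_closure (\<lambda>x. ereal (f x)) x\<^sub>0"
  \<comment> \<open>Testing against real upper bounds \<open>d\<close> avoids a case distinction on
    whether the closure is finite at \<open>x\<^sub>0\<close>.\<close>
  proof (rule ereal_le_real)
    show "(INF g\<in>Sigma_Lip_plus (\<lambda>x. ereal (f x)). g x\<^sub>0) \<le> ereal d"
      if "usc_closure (\<lambda>x. ereal (f x)) x\<^sub>0 \<le> ereal d" for d
    \<comment> \<open>The slack \<open>e\<close> makes the bound on the closure strict, as is needed
      to keep \<open>f\<close> below \<open>d + e\<close> on a whole neighbourhood.\<close>
    proof (rule ereal_le_epsilon2)
      fix e :: real
      assume "0 < e"
      then have "usc_closure (\<lambda>x. ereal (f x)) x\<^sub>0 < ereal (d + e)"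
        using that by (auto intro: le_less_trans)
      then obtain M where M: "0 \<le> M" "\<And>y. f y \<le> (d + e) + M * norm (y - x\<^sub>0)"
        using lipschitz_bounded_below_cone[OF assms] by blast
      obtain g where g: "convex_on UNIV g" "f \<le> g" "g \<le> (\<lambda>y. (d + e) + M * norm (y - x\<^sub>0))"
        "\<And>k. convex_on UNIV k \<Longrightarrow> f \<le> k \<Longrightarrow> k \<le> g \<Longrightarrow> k = g"
        using ex_minimal_convex_on_between[OF convex_on_cone[OF M(1)], of f "d + e" x\<^sub>0] M(2)
        by (auto simp: le_fun_def)
      have "M-lipschitz_on UNIV g"
        using convex_on_linear_growth_imp_lipschitz[OF g(1) _ M(1)] g(3) by (auto simp: le_fun_def)
      then have "(\<lambda>x. ereal (g x)) \<in> Sigma_Lip_plus (\<lambda>x. ereal (f x))"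
        using g by (auto simp: Sigma_Lip_plus_def minimal_convex_majorant_ereal_iff
            lipschitz_continuous_def)
      then have "(INF g\<in>Sigma_Lip_plus (\<lambda>x. ereal (f x)). g x\<^sub>0) \<le> ereal (g x\<^sub>0)"
        by (rule INF_lower)
      \<comment> \<open>At its apex \<open>x\<^sub>0\<close> the cone above \<open>g\<close> has the
        value \<open>d + e\<close>.\<close>
      also have "\<dots> \<le> ereal d + ereal e"
        using g(3) by (auto simp: le_fun_def dest: spec[of _ x\<^sub>0])
      finally show "(INF g\<in>Sigma_Lip_plus (\<lambda>x. ereal (f x)). g x\<^sub>0) \<le> ereal d + ereal e" .
    qed
  qed
qed

end
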